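(* Let $\varrho\in\mathcal{R}_p(1)$. Then: (a) the map $f_\varrho:\mathrm{CExt}\mathbf{E}\to\mathrm{CExt}\mathbf{E}$, $f_\varrho(\mathbf{S})=\mathbf{S}_\varrho:=\{\varphi*\varrho:\varphi\in\mathbf{S}\}$, is well defined (i.e. $\mathbf{S}_\varrho$, closed under $\approx$, is again a classical modal logic) and is a lattice automorphism of $\mathrm{CExt}\mathbf{E}$; (b) the set $\mathcal{A}_p(1)=\{f_\varrho:\varrho\in\mathcal{R}_p(1)\}$ is a group (under composition of maps) of automorphisms of $\mathrm{CExt}\mathbf{E}$, and it is isomorphic to the symmetric group $\mathrm{S}_4$.
   Context: Language: propositional variables $p_1,p_2,\dots$, constants $0$ (falsum) and $1$ (verum), connectives $\neg,\vee$ (with $\wedge,\to,\leftrightarrow$ as the usual abbreviations) and one modal operator $\lozenge$; $\square\varphi$ abbreviates $\neg\lozenge\neg\varphi$. The minimal classical modal logic $\mathbf{E}$ is the smallest set of formulas containing all propositional tautologies and closed under modus ponens (MP), uniform substitution (US) and the congruence rule RE: from $\varphi\leftrightarrow\psi$ infer $\lozenge\varphi\leftrightarrow\lozenge\psi$. A classical modal logic is a set of formulas containing $\mathbf{E}$ and closed under MP, US and RE; $\mathrm{CExt}\mathbf{E}$ is the set of all classical modal logics (including the inconsistent logic $\mathbf{F}$ of all formulas), ordered by inclusion; it is a lattice whose meet is $\mathbf{S}'\cap\mathbf{S}''$ and whose join is the closure of $\mathbf{S}'\cup\mathbf{S}''$ under MP, US and RE. Write $\varphi\approx\psi$ if $\vdash_{\mathbf{E}}\varphi\leftrightarrow\psi$.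 Uniform replacements (URs): a UR is a formula $\rho(e)$ of modal degree at most 1 in the single variable $e$ (considered up to $\approx$). For any formula $\varphi$, the formula $\varphi*\rho$ is defined recursively by: $0*\rho=0$, $1*\rho=1$, $p_i*\rho=p_i$, $(\psi\vee\theta)*\rho=(\psi*\rho)\vee(\theta*\rho)$, $(\neg\psi)*\rho=\neg(\psi*\rho)$, $(\lozenge\psi)*\rho=\rho(\psi*\rho)$ (the result of substituting $\psi*\rho$ for $e$ in $\rho(e)$); abbreviated connectives and $\square$ are first expanded. The composition of URs is $\rho\rho':=\rho*\rho'$ (the UR $\rho'$ applied to the formula $\rho(e)$). $\mathcal{R}_p(1)$ (the prime URs) is the following set of 24 URs: all formulas $\lambda\leftrightarrow\tau$ with $\lambda\in\{\lozenge e,\neg\lozenge e\}$ and $\tau\in\{1,\ e,\ e\vee\lozenge\neg e,\ e\vee\neg\lozenge\neg e,\ \neg e\vee\lozenge\neg e,\ \neg e\vee\neg\lozenge\neg e\}$, together with all formulas $\lambda\leftrightarrow\tau$ with $\lambda\in\{\lozenge\neg e,\neg\lozenge\neg e\}$ and $\tau\in\{1,\ e,\ e\vee\lozenge e,\ e\vee\neg\lozenge e,\ \neg e\vee\lozenge e,\ \neg e\vee\neg\lozenge e\}$ (so e.g. $\lozenge e\leftrightarrow 1$ is just $\lozenge e$). *)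

theory Defs
  imports "HOL-Algebra.Sym_Groups" "HOL-Algebra.Bij" "HOL-Algebra.Lattice"
begin

datatype fm =
    Var nat
  | Fls
  | Tru
  | Neg fm
  | Or fm fm
  | Dia fm

abbreviation And :: "fm \<Rightarrow> fm \<Rightarrow> fm"
  where "And p q \<equiv> Neg (Or (Neg p) (Neg q))"

abbreviation Imp :: "fm \<Rightarrow> fm \<Rightarrow> fm"
  where "Imp p q \<equiv> Or (Neg p) q"

abbreviation Iff :: "fm \<Rightarrow> fm \<Rightarrow> fm"
  where "Iff p q \<equiv> And (Imp p q) (Imp q p)"

primrec fvars :: "fm \<Rightarrow> nat set" where
  "fvars (Var i) = {i}"
| "fvars Fls = {}"
| "fvars Tru = {}"
| "fvars (Neg p) = fvars p"
| "fvars (Or p q) = fvars p \<union> fvars q"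
| "fvars (Dia p) = fvars p"

primrec mdegree :: "fm \<Rightarrow> nat" where
  "mdegree (Var i) = 0"
| "mdegree Fls = 0"
| "mdegree Tru = 0"
| "mdegree (Neg p) = mdegree p"
| "mdegree (Or p q) = max (mdegree p) (mdegree q)"
| "mdegree (Dia p) = Suc (mdegree p)"

primrec subst :: "(nat \<Rightarrow> fm) \<Rightarrow> fm \<Rightarrow> fm" where
  "subst s (Var i) = s i"
| "subst s Fls = Fls"
| "subst s Tru = Tru"
| "subst s (Neg p) = Neg (subst s p)"
| "subst s (Or p q) = Or (subst s p) (subst s q)"
| "subst s (Dia p) = Dia (subst s p)"

text \<open>
  Boolean evaluation. Formulas \<open>Dia p\<close> are treated as further atoms, with truth values
  given by \<open>d\<close>.
\<close>

primrec beval :: "(nat \<Rightarrow> bool) \<Rightarrow> (fm \<Rightarrow> bool) \<Rightarrow> fm \<Rightarrow> bool" where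
  "beval v d (Var i) \<longleftrightarrow> v i"
| "beval v d Fls \<longleftrightarrow> False"
| "beval v d Tru \<longleftrightarrow> True"
| "beval v d (Neg p) \<longleftrightarrow> \<not> beval v d p"
| "beval v d (Or p q) \<longleftrightarrow> beval v d p \<or> beval v d q"
| "beval v d (Dia p) \<longleftrightarrow> d p"

definition tautologies :: "fm set"
  where "tautologies = {p. \<forall>v d. beval v d p}"

inductive_set logic_closure :: "fm set \<Rightarrow> fm set" for X where
  base: "p \<in> X \<Longrightarrow> p \<in> logic_closure X"
| MP: "p \<in> logic_closure X \<Longrightarrow> Imp p q \<in> logic_closure X \<Longrightarrow> q \<in> logic_closure X"
| US: "p \<in> logic_closure X \<Longrightarrow> subst s p \<in> logic_closure X"
| RE: "Iff p q \<in> logic_closure X \<Longrightarrow> Iff (Dia p) (Dia q) \<in> logic_closure X"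

definition logic_E :: "fm set"
  where "logic_E = logic_closure tautologies"

definition CExtE :: "fm set set"
  where "CExtE = {S. logic_E \<subseteq> S
    \<and> (\<forall>p q. p \<in> S \<longrightarrow> Imp p q \<in> S \<longrightarrow> q \<in> S)
    \<and> (\<forall>p s. p \<in> S \<longrightarrow> subst s p \<in> S)
    \<and> (\<forall>p q. Iff p q \<in> S \<longrightarrow> Iff (Dia p) (Dia q) \<in> S)}"

definition CExtE_lattice :: "fm set gorder"
  where "CExtE_lattice = \<lparr>carrier = CExtE, eq = (=), le = (\<subseteq>)\<rparr>"

definition E_equiv :: "fm \<Rightarrow> fm \<Rightarrow> bool"  (infix \<open>\<approx>\<close> 50)
  where "p \<approx> q \<longleftrightarrow> Iff p q \<in> logic_E"

text \<open>The single variable of a uniform replacement is the variable with index 0.\<close>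

abbreviation e :: fm
  where "e \<equiv> Var 0"

definition UR :: "fm set"
  where "UR = {r. fvars r \<subseteq> {0} \<and> mdegree r \<le> 1}"

primrec replace :: "fm \<Rightarrow> fm \<Rightarrow> fm"  (infixl \<open>\<star>\<close> 70) where
  "Var i \<star> r = Var i"
| "Fls \<star> r = Fls"
| "Tru \<star> r = Tru"
| "Neg p \<star> r = Neg (p \<star> r)"
| "Or p q \<star> r = Or (p \<star> r) (q \<star> r)"
| "Dia p \<star> r = subst (Var(0 := p \<star> r)) r"

definition prime_forms :: "fm set"
  where "prime_forms =
    {Iff l t | l t. l \<in> {Dia e, Neg (Dia e)} \<and>
       t \<in> {Tru, e, Or e (Dia (Neg e)), Or e (Neg (Dia (Neg e))),
            Or (Neg e) (Dia (Neg e)), Or (Neg e) (Neg (Dia (Neg e)))}} \<union>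
    {Iff l t | l t. l \<in> {Dia (Neg e), Neg (Dia (Neg e))} \<and>
       t \<in> {Tru, e, Or e (Dia e), Or e (Neg (Dia e)),
            Or (Neg e) (Dia e), Or (Neg e) (Neg (Dia e))}}"

text \<open>
  Uniform replacements are considered up to \<open>\<approx>\<close>, so a prime one is any uniform
  replacement equivalent to one of the 24 displayed forms (for instance \<open>Dia e\<close>, which is
  equivalent to \<open>Iff (Dia e) Tru\<close>).
\<close>

definition prime_UR :: "fm set"
  where "prime_UR = {r \<in> UR. \<exists>r' \<in> prime_forms. r \<approx> r'}"

definition replace_logic :: "fm \<Rightarrow> fm set \<Rightarrow> fm set"
  where "replace_logic r S = {q. \<exists>p \<in> S. q \<approx> p \<star> r}"

definition replace_map :: "fm \<Rightarrow> fm set \<Rightarrow> fm set"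
  where "replace_map r = (\<lambda>S \<in> CExtE. replace_logic r S)"

definition lattice_auto :: "('a, 'b) gorder_scheme \<Rightarrow> ('a \<Rightarrow> 'a) set"
  where "lattice_auto L = {f \<in> Bij (carrier L). \<forall>x \<in> carrier L. \<forall>y \<in> carrier L.
    f (x \<sqinter>\<^bsub>L\<^esub> y) = f x \<sqinter>\<^bsub>L\<^esub> f y \<and> f (x \<squnion>\<^bsub>L\<^esub> y) = f x \<squnion>\<^bsub>L\<^esub> f y}"

definition prime_autos :: "(fm set \<Rightarrow> fm set) set"
  where "prime_autos = replace_map ` prime_UR"


lemma prime_forms_UR: "prime_forms \<subseteq> UR"
  unfolding prime_forms_def UR_def by auto

lemma card_prime_forms: "card prime_forms = 24"
proof -
  let ?f = "\<lambda>(l, t). Iff l t"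
  let ?A = "{Dia e, Neg (Dia e)} \<times>
    {Tru, e, Or e (Dia (Neg e)), Or e (Neg (Dia (Neg e))),
     Or (Neg e) (Dia (Neg e)), Or (Neg e) (Neg (Dia (Neg e)))}"
  let ?B = "{Dia (Neg e), Neg (Dia (Neg e))} \<times>
    {Tru, e, Or e (Dia e), Or e (Neg (Dia e)),
     Or (Neg e) (Dia e), Or (Neg e) (Neg (Dia e))}"
  have image: "{Iff l t | l t. l \<in> X \<and> t \<in> Y} = ?f ` (X \<times> Y)" for X Y
    by force
  have forms: "prime_forms = ?f ` (?A \<union> ?B)"
    unfolding prime_forms_def image image_Un by (rule refl)
  have inj: "inj_on ?f (?A \<union> ?B)"
  proof -
    have "inj ?f"
      by (rule injI) (simp add: case_prod_beta prod_eq_iff)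
    then show ?thesis
      by (rule inj_on_subset) (rule subset_UNIV)
  qed
  have card: "card (?A \<union> ?B) = 24"
  proof -
    have "?A \<inter> ?B = {}"
      by (simp add: Times_Int_Times)
    then have "card (?A \<union> ?B) = card ?A + card ?B"
      by (intro card_Un_disjoint) simp_all
    then show ?thesis
      by (simp add: card_cartesian_product)
  qed
  show ?thesis
    unfolding forms card_image[OF inj] by (rule card)
qed

lemma logic_closure_in_CExtE: "logic_E \<subseteq> X \<Longrightarrow> logic_closure X \<in> CExtE"
  unfolding CExtE_def mem_Collect_eq
  by (intro conjI allI impI)
    (blast intro: logic_closure.base, erule (1) logic_closure.MP,
      erule logic_closure.US, erule logic_closure.RE)

lemma logic_closure_least:
  assumes "S \<in> CExtE" "X \<subseteq> S"
  shows "logic_closure X \<subseteq> S"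
proof
  have MP: "p \<in> S \<Longrightarrow> Imp p q \<in> S \<Longrightarrow> q \<in> S"
    and US: "p \<in> S \<Longrightarrow> subst s p \<in> S"
    and RE: "Iff p q \<in> S \<Longrightarrow> Iff (Dia p) (Dia q) \<in> S" for p q s
    using assms(1) unfolding CExtE_def mem_Collect_eq by meson+
  fix p assume "p \<in> logic_closure X"
  then show "p \<in> S"
    by induction (use assms(2) in blast, erule (1) MP, erule US, erule RE)
qed

lemma logic_E_in_CExtE: "logic_E \<in> CExtE"
  unfolding CExtE_def logic_E_def mem_Collect_eq
  by (intro conjI allI impI)
    (rule subset_refl, erule (1) logic_closure.MP,
      erule logic_closure.US, erule logic_closure.RE)

lemma CExtE_imp_E_subset: "S \<in> CExtE \<Longrightarrow> logic_E \<subseteq> S"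
  unfolding CExtE_def mem_Collect_eq by (rule conjunct1)

lemma CExtE_Int: "S \<in> CExtE \<Longrightarrow> T \<in> CExtE \<Longrightarrow> S \<inter> T \<in> CExtE"
  unfolding CExtE_def mem_Collect_eq Int_iff by (simp only: le_inf_iff) meson

lemma CExtE_join_least:
  assumes "S \<in> CExtE" "T \<in> CExtE"
  shows "least CExtE_lattice (logic_closure (S \<union> T)) (Upper CExtE_lattice {S, T})"
proof -
  have "logic_closure (S \<union> T) \<in> CExtE"
    using CExtE_imp_E_subset[OF assms(1)] by (intro logic_closure_in_CExtE) (rule le_supI1)
  then show ?thesis
    using assms logic_closure_least[of _ "S \<union> T"]
    by (auto simp: least_def Upper_def CExtE_lattice_def intro: logic_closure.base)
qed

lemma CExtE_meet_greatest:
  assumes "S \<in> CExtE" "T \<in> CExtE"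
  shows "greatest CExtE_lattice (S \<inter> T) (Lower CExtE_lattice {S, T})"
  using assms CExtE_Int[OF assms]
  by (auto simp: greatest_def Lower_def CExtE_lattice_def)

lemma lattice_CExtE: "lattice CExtE_lattice"
proof -
  interpret partial_order CExtE_lattice
    by unfold_locales (auto simp: CExtE_lattice_def)
  show ?thesis
  proof unfold_locales
    fix S T
    assume "S \<in> carrier CExtE_lattice" "T \<in> carrier CExtE_lattice"
    then have *: "S \<in> CExtE" "T \<in> CExtE"
      by (simp_all add: CExtE_lattice_def)
    show "\<exists>U. least CExtE_lattice U (Upper CExtE_lattice {S, T})"
      using CExtE_join_least[OF *] by (rule exI)
    show "\<exists>U. greatest CExtE_lattice U (Lower CExtE_lattice {S, T})"
      using CExtE_meet_greatest[OF *] by (rule exI)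
  qed
qed

lemma CExtE_join:
  assumes "S \<in> CExtE" "T \<in> CExtE"
  shows "S \<squnion>\<^bsub>CExtE_lattice\<^esub> T = logic_closure (S \<union> T)"
proof -
  interpret lattice CExtE_lattice by (rule lattice_CExtE)
  show ?thesis
    unfolding join_def sup_def
    by (rule some_equality, rule CExtE_join_least[OF assms])
      (erule least_unique, rule CExtE_join_least[OF assms])
qed

lemma CExtE_meet:
  assumes "S \<in> CExtE" "T \<in> CExtE"
  shows "S \<sqinter>\<^bsub>CExtE_lattice\<^esub> T = S \<inter> T"
proof -
  interpret lattice CExtE_lattice by (rule lattice_CExtE)
  show ?thesis
    unfolding meet_def inf_def
    by (rule some_equality, rule CExtE_meet_greatest[OF assms])
      (erule greatest_unique, rule CExtE_meet_greatest[OF assms])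
qed

end

theory Submission
  imports Defs
begin

text \<open>
  A one-point neighbourhood frame is given by the pair \<open>s\<close> of truth values of \<open>Dia Tru\<close> and
  \<open>Dia Fls\<close>. A uniform replacement \<open>r\<close> turns the frame \<open>s\<close> into the frame \<open>point_action r s\<close>, and
  composition of replacements becomes composition of these self-maps of the four frames. A Boolean
  combination of \<open>e\<close>, \<open>Dia e\<close>, \<open>Dia (Neg e)\<close> is determined up to \<open>\<approx>\<close> by its action. The 24 prime
  forms act by distinct permutations, hence by all of them, so every prime replacement \<open>r\<close> has a
  prime inverse \<open>r'\<close>. The image of a logic \<open>S\<close> under \<open>r\<close> is then the preimage \<open>{q. q \<star> r' \<in> S}\<close>,
  which is visibly a logic, and \<open>S \<mapsto> replace_logic r S\<close> is an order automorphism. It sends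
  the logic of the frame \<open>point_action r s\<close> to that of \<open>s\<close>, so distinct permutations induce
  distinct automorphisms.
\<close>

section \<open>Lattice automorphisms and symmetric groups\<close>

lemma (in lattice) order_iso_join:
  assumes Bij: "f \<in> Bij (carrier L)"
    and le_iff: "\<And>x y. x \<in> carrier L \<Longrightarrow> y \<in> carrier L \<Longrightarrow> f x \<sqsubseteq> f y \<longleftrightarrow> x \<sqsubseteq> y"
    and in_carrier: "x \<in> carrier L" "y \<in> carrier L"
  shows "f (x \<squnion> y) = f x \<squnion> f y"
proof (rule le_antisym)
  have closed: "f z \<in> carrier L" if "z \<in> carrier L" for z
    using Bij_imp_funcset[OF Bij] that by (rule funcset_mem)
  show "f x \<squnion> f y \<sqsubseteq> f (x \<squnion> y)"
    using in_carrier by (intro join_le) (simp_all add: closed le_iff join_left join_right)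
  have "f x \<squnion> f y \<in> f ` carrier L"
    using Bij in_carrier by (simp add: Bij_def bij_betw_def closed)
  then obtain z where z: "z \<in> carrier L" "f x \<squnion> f y = f z"
    by blast
  then have "f x \<sqsubseteq> f z" "f y \<sqsubseteq> f z"
    using in_carrier closed join_left join_right by metis+
  then show "f (x \<squnion> y) \<sqsubseteq> f x \<squnion> f y"
    using in_carrier z by (simp add: le_iff join_le)
  show "f (x \<squnion> y) \<in> carrier L" "f x \<squnion> f y \<in> carrier L"
    using in_carrier by (simp_all add: closed)
qed

lemma (in lattice) order_iso_lattice_auto:
  assumes Bij: "f \<in> Bij (carrier L)"
    and le_iff: "\<And>x y. x \<in> carrier L \<Longrightarrow> y \<in> carrier L \<Longrightarrow> f x \<sqsubseteq> f y \<longleftrightarrow> x \<sqsubseteq> y"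
  shows "f \<in> lattice_auto L"
proof -
  have "f (x \<squnion> y) = f x \<squnion> f y" if "x \<in> carrier L" "y \<in> carrier L" for x y
    using Bij le_iff that by (rule order_iso_join)
  moreover have "f (x \<sqinter> y) = f x \<sqinter> f y" if "x \<in> carrier L" "y \<in> carrier L" for x y
    using lattice.order_iso_join[OF dual_lattice, of f x y] Bij le_iff that by simp
  ultimately show ?thesis
    using Bij by (simp add: lattice_auto_def)
qed

definition conj_perm :: "('a \<Rightarrow> 'b) \<Rightarrow> 'a set \<Rightarrow> 'b set \<Rightarrow> ('a \<Rightarrow> 'a) \<Rightarrow> 'b \<Rightarrow> 'b"
  where "conj_perm h A B f = (\<lambda>y. if y \<in> B then h (f (inv_into A h y)) else y)"

lemma conj_perm_permutes:
  assumes bij_h: "bij_betw h A B" and "f \<in> Bij A"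
  shows "conj_perm h A B f permutes B"
proof (rule bij_imp_permutes)
  have "bij_betw f A A"
    using assms(2) by (simp add: Bij_def)
  then have "bij_betw (h \<circ> (f \<circ> inv_into A h)) B B"
    by (rule bij_betw_trans[OF bij_betw_trans[OF bij_betw_inv_into[OF bij_h]] bij_h])
  moreover have "bij_betw (h \<circ> (f \<circ> inv_into A h)) B B \<longleftrightarrow> bij_betw (conj_perm h A B f) B B"
    by (rule bij_betw_cong) (simp add: conj_perm_def)
  ultimately show "bij_betw (conj_perm h A B f) B B"
    by (rule iffD1[rotated])
qed (simp add: conj_perm_def)

lemma bij_betw_conj_perm:
  assumes bij_h: "bij_betw h A B"
  shows "bij_betw (conj_perm h A B) (Bij A) {p. p permutes B}"
proof (rule bij_betw_byWitness[where f' = "\<lambda>p. \<lambda>x \<in> A. inv_into A h (p (h x))"]; safe)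
  show "(\<lambda>x \<in> A. inv_into A h (conj_perm h A B f (h x))) = f" if "f \<in> Bij A" for f
    using bij_betwE[OF bij_h] Bij_imp_funcset[OF that] Bij_imp_extensional[OF that]
    by (intro extensionalityI[of _ A])
      (simp_all add: conj_perm_def bij_betw_inv_into_left[OF bij_h] Pi_iff)
  show "conj_perm h A B (\<lambda>x \<in> A. inv_into A h (p (h x))) = p" if "p permutes B" for p
    using bij_betwE[OF bij_betw_inv_into[OF bij_h]] permutes_in_image[OF that]
      permutes_not_in[OF that]
    by (intro ext) (simp add: conj_perm_def bij_betw_inv_into_right[OF bij_h])
  show "(\<lambda>x \<in> A. inv_into A h (p (h x))) \<in> Bij A" if "p permutes B" for p
    using bij_betw_trans[OF bij_betw_trans[OF bij_h permutes_imp_bij[OF that]]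
        bij_betw_inv_into[OF bij_h]]
    by (simp add: Bij_def comp_def)
qed (rule conj_perm_permutes[OF bij_h])

lemma conj_perm_compose:
  assumes bij_h: "bij_betw h A B" and "g \<in> Bij A"
  shows "conj_perm h A B (compose A f g) = conj_perm h A B f \<circ> conj_perm h A B g"
  using bij_betwE[OF bij_h] bij_betwE[OF bij_betw_inv_into[OF bij_h]] Bij_imp_funcset[OF assms(2)]
  by (intro ext) (simp add: conj_perm_def compose_def bij_betw_inv_into_left[OF bij_h] Pi_iff)

lemma BijGroup_iso_sym_group:
  assumes "finite A"
  shows "BijGroup A \<cong> sym_group (card A)"
proof -
  have "\<exists>h. bij_betw h A {1..card A}"
    by (rule finite_same_card_bij[OF assms]) simp_all
  then obtain h where bij_h: "bij_betw h A {1..card A}" ..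
  have "conj_perm h A {1..card A} \<in> iso (BijGroup A) (sym_group (card A))"
    using bij_betw_conj_perm[OF bij_h] conj_perm_compose[OF bij_h] conj_perm_permutes[OF bij_h]
    by (intro isoI homI) (simp_all add: BijGroup_def sym_group_def)
  then show ?thesis
    by (rule is_isoI)
qed

section \<open>Classical modal logics\<close>

lemma CExtE_I:
  assumes "\<And>p. p \<in> tautologies \<Longrightarrow> p \<in> S"
    and "\<And>p q. p \<in> S \<Longrightarrow> Imp p q \<in> S \<Longrightarrow> q \<in> S"
    and "\<And>p s. p \<in> S \<Longrightarrow> subst s p \<in> S"
    and "\<And>p q. Iff p q \<in> S \<Longrightarrow> Iff (Dia p) (Dia q) \<in> S"
  shows "S \<in> CExtE"
proof -
  have "p \<in> S" if "p \<in> logic_closure tautologies" for p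
    using that
    by induction (erule assms(1), erule (1) assms(2), erule assms(3), erule assms(4))
  then show ?thesis
    unfolding CExtE_def logic_E_def using assms(2-) by (intro CollectI conjI allI impI subsetI)
qed

lemma
  assumes "S \<in> CExtE"
  shows CExtE_MP: "p \<in> S \<Longrightarrow> Imp p q \<in> S \<Longrightarrow> q \<in> S"
    and CExtE_US: "p \<in> S \<Longrightarrow> subst s p \<in> S"
    and CExtE_RE: "Iff p q \<in> S \<Longrightarrow> Iff (Dia p) (Dia q) \<in> S"
  using assms unfolding CExtE_def mem_Collect_eq by meson+

lemma CExtE_tautology:
  assumes "S \<in> CExtE" "\<And>v d. beval v d p"
  shows "p \<in> S"
proof -
  have "p \<in> logic_E"
    unfolding logic_E_def by (rule logic_closure.base) (simp add: tautologies_def assms(2))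
  then show ?thesis
    using CExtE_imp_E_subset[OF assms(1)] by (rule rev_subsetD)
qed

lemma CExtE_conseq:
  assumes logic: "S \<in> CExtE"
    and "finite P" "P \<subseteq> S" "\<And>v d. \<forall>p \<in> P. beval v d p \<Longrightarrow> beval v d q"
  shows "q \<in> S"
  using assms(2-)
proof (induction P arbitrary: q)
  case empty
  then show ?case
    by (intro CExtE_tautology[OF logic]) simp
next
  case (insert p P)
  have "beval v d (Imp p q)" if "\<forall>p \<in> P. beval v d p" for v d
    using insert.prems(2)[of v d] that by auto
  then have "Imp p q \<in> S"
    using insert.prems(1) by (intro insert.IH) simp_all
  moreover have "p \<in> S"
    using insert.prems(1) by simp
  ultimately show ?case
    by (rule CExtE_MP[OF logic, rotated])
qed

lemma beval_Iff: "beval v d (Iff p q) \<longleftrightarrow> (beval v d p \<longleftrightarrow> beval v d q)"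
  by auto

lemma Iff_refl: "S \<in> CExtE \<Longrightarrow> Iff p p \<in> S"
  by (erule CExtE_tautology) simp

lemma Iff_sym:
  assumes "S \<in> CExtE" "Iff p q \<in> S"
  shows "Iff q p \<in> S"
  by (rule CExtE_conseq[where P = "{Iff p q}"], simp_all only: ball_simps beval_Iff)
    (use assms in auto)

lemma Iff_trans:
  assumes "S \<in> CExtE" "Iff p q \<in> S" "Iff q r \<in> S"
  shows "Iff p r \<in> S"
  by (rule CExtE_conseq[where P = "{Iff p q, Iff q r}"], simp_all only: ball_simps beval_Iff)
    (use assms in auto)

lemma Iff_mem:
  assumes "S \<in> CExtE" "Iff p q \<in> S" "p \<in> S"
  shows "q \<in> S"
  by (rule CExtE_conseq[where P = "{Iff p q, p}"], simp_all only: ball_simps beval_Iff)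
    (use assms in auto)

lemma Iff_Neg:
  assumes "S \<in> CExtE" "Iff p q \<in> S"
  shows "Iff (Neg p) (Neg q) \<in> S"
  by (rule CExtE_conseq[where P = "{Iff p q}"], simp_all only: ball_simps beval_Iff)
    (use assms in auto)

lemma Iff_Or:
  assumes "S \<in> CExtE" "Iff p q \<in> S" "Iff p' q' \<in> S"
  shows "Iff (Or p p') (Or q q') \<in> S"
  by (rule CExtE_conseq[where P = "{Iff p q, Iff p' q'}"], simp_all only: ball_simps beval_Iff)
    (use assms in auto)

lemma Iff_subst:
  assumes "S \<in> CExtE" "\<And>i. Iff (s i) (t i) \<in> S"
  shows "Iff (subst s p) (subst t p) \<in> S"
  by (induction p)
    (simp_all only: subst.simps assms Iff_refl Iff_Neg Iff_Or CExtE_RE)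

lemma Iff_subst_e:
  assumes "S \<in> CExtE" "Iff p q \<in> S"
  shows "Iff (subst (Var(0 := p)) r) (subst (Var(0 := q)) r) \<in> S"
  by (rule Iff_subst) (use assms Iff_refl in auto)

lemma E_equiv_refl: "p \<approx> p"
  and E_equiv_sym: "p \<approx> q \<Longrightarrow> q \<approx> p"
  and E_equiv_trans [trans]: "p \<approx> q \<Longrightarrow> q \<approx> r \<Longrightarrow> p \<approx> r"
  unfolding E_equiv_def
  by (rule Iff_refl[OF logic_E_in_CExtE], erule Iff_sym[OF logic_E_in_CExtE],
      erule (1) Iff_trans[OF logic_E_in_CExtE])

lemma E_equiv_mem_iff: "S \<in> CExtE \<Longrightarrow> p \<approx> q \<Longrightarrow> p \<in> S \<longleftrightarrow> q \<in> S"
  unfolding E_equiv_def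
  using CExtE_imp_E_subset[of S] Iff_mem[of S p q] Iff_mem[of S q p] Iff_sym[of S p q] by blast

section \<open>Uniform replacements\<close>

lemma subst_subst: "subst s (subst t p) = subst (\<lambda>i. subst s (t i)) p"
  by (induction p) auto

lemma subst_fvars_cong: "(\<And>i. i \<in> fvars p \<Longrightarrow> s i = t i) \<Longrightarrow> subst s p = subst t p"
  by (induction p) auto

lemma subst_Var: "subst Var p = p"
  by (induction p) auto

lemma replace_subst:
  assumes "fvars r \<subseteq> {0}"
  shows "subst s p \<star> r = subst (\<lambda>i. s i \<star> r) (p \<star> r)"
proof (induction p)
  case (Dia p)
  then show ?case
    unfolding replace.simps subst.simps subst_subst
    by (intro subst_fvars_cong) (use assms in auto)
qed auto

lemma replace_assoc:
  assumes "fvars r' \<subseteq> {0}"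
  shows "(p \<star> r) \<star> r' = p \<star> (r \<star> r')"
proof (induction p)
  case (Dia p)
  then show ?case
    unfolding replace.simps replace_subst[OF assms]
    by (intro subst_fvars_cong) auto
qed auto

lemma replace_Dia_e: "p \<star> Dia e = p"
  by (induction p) auto

lemma E_equiv_replace_right:
  assumes "r \<approx> r'"
  shows "p \<star> r \<approx> p \<star> r'"
  unfolding E_equiv_def
proof (induction p)
  case (Dia p)
  have "Iff (subst (Var(0 := p \<star> r)) r) (subst (Var(0 := p \<star> r')) r) \<in> logic_E"
    by (rule Iff_subst_e[OF logic_E_in_CExtE Dia])
  moreover have "Iff (subst (Var(0 := p \<star> r')) r) (subst (Var(0 := p \<star> r')) r') \<in> logic_E"
    using CExtE_US[OF logic_E_in_CExtE assms[unfolded E_equiv_def]] by simp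
  ultimately show ?case
    unfolding replace.simps by (rule Iff_trans[OF logic_E_in_CExtE])
qed (simp_all only: replace.simps Iff_refl Iff_Neg Iff_Or logic_E_in_CExtE)

lemma beval_replace: "beval v d (p \<star> r) = beval v (\<lambda>q. beval v d (Dia q \<star> r)) p"
  by (induction p) auto

lemma replace_vimage_CExtE:
  assumes "fvars r \<subseteq> {0}" and logic: "S \<in> CExtE"
  shows "{p. p \<star> r \<in> S} \<in> CExtE"
proof (rule CExtE_I; unfold mem_Collect_eq)
  show "p \<star> r \<in> S" if "p \<in> tautologies" for p
    using that by (intro CExtE_tautology[OF logic])
      (simp add: tautologies_def beval_replace[of _ _ p])
  show "q \<star> r \<in> S" if "p \<star> r \<in> S" "Imp p q \<star> r \<in> S" for p q
    using CExtE_MP[OF logic that(1)] that(2) by simp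
  show "subst s p \<star> r \<in> S" if "p \<star> r \<in> S" for p s
    unfolding replace_subst[OF assms(1)] by (rule CExtE_US[OF logic that])
  show "Iff (Dia p) (Dia q) \<star> r \<in> S" if "Iff p q \<star> r \<in> S" for p q
    using Iff_subst_e[OF logic, of "p \<star> r" "q \<star> r" r] that by simp
qed

lemma E_equiv_replace_left:
  assumes "fvars r \<subseteq> {0}" "p \<approx> q"
  shows "p \<star> r \<approx> q \<star> r"
proof -
  have "Iff p q \<in> {p. p \<star> r \<in> logic_E}"
    using CExtE_imp_E_subset[OF replace_vimage_CExtE[OF assms(1) logic_E_in_CExtE]]
      assms(2)[unfolded E_equiv_def] by (rule subsetD)
  then show ?thesis
    by (simp add: E_equiv_def)
qed

lemma replace_map_cong:
  assumes "r \<approx> r'"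
  shows "replace_map r = replace_map r'"
proof -
  have "q \<approx> p \<star> r \<longleftrightarrow> q \<approx> p \<star> r'" for p q
    using E_equiv_trans[of q] E_equiv_replace_right[OF assms, of p] E_equiv_sym by blast
  then show ?thesis
    unfolding replace_map_def replace_logic_def by simp
qed

lemma replace_logic_replace_logic:
  assumes "fvars q \<subseteq> {0}"
  shows "replace_logic q (replace_logic r S) = replace_logic (r \<star> q) S"
proof -
  have "x \<approx> p \<star> r \<star> q" if "x \<approx> y \<star> q" "y \<approx> p \<star> r" for x y p
    using that(1) E_equiv_replace_left[OF assms that(2)] by (rule E_equiv_trans)
  then show ?thesis
    unfolding replace_logic_def replace_assoc[OF assms, symmetric] using E_equiv_refl by blast
qed

locale invertible_UR =
  fixes r r' :: fm
  assumes fvars: "fvars r \<subseteq> {0}" and fvars_inverse: "fvars r' \<subseteq> {0}"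
    and replace_inverse: "r \<star> r' \<approx> Dia e" and inverse_replace: "r' \<star> r \<approx> Dia e"
begin

lemma replace_replace_inverse: "p \<star> r \<star> r' \<approx> p"
  using E_equiv_replace_right[OF replace_inverse, of p]
  by (simp add: replace_assoc[OF fvars_inverse] replace_Dia_e)

lemma replace_inverse_replace: "p \<star> r' \<star> r \<approx> p"
  using E_equiv_replace_right[OF inverse_replace, of p]
  by (simp add: replace_assoc[OF fvars] replace_Dia_e)

lemma replace_logic_eq_vimage:
  assumes "S \<in> CExtE"
  shows "replace_logic r S = {q. q \<star> r' \<in> S}"
proof -
  have "q \<star> r' \<in> S" if "p \<in> S" "q \<approx> p \<star> r" for p q
  proof -
    have "q \<star> r' \<approx> p \<star> r \<star> r'"
      using fvars_inverse that(2) by (rule E_equiv_replace_left)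
    also have "\<dots> \<approx> p"
      by (rule replace_replace_inverse)
    finally show ?thesis
      using E_equiv_mem_iff[OF assms] that(1) by blast
  qed
  moreover have "q \<approx> q \<star> r' \<star> r" for q
    by (rule E_equiv_sym[OF replace_inverse_replace])
  ultimately show ?thesis
    unfolding replace_logic_def by blast
qed

lemma replace_logic_CExtE: "S \<in> CExtE \<Longrightarrow> replace_logic r S \<in> CExtE"
  by (simp add: replace_logic_eq_vimage replace_vimage_CExtE fvars_inverse)

lemma replace_logic_vimage:
  assumes "S \<in> CExtE"
  shows "replace_logic r {p. p \<star> r \<in> S} = S"
  using E_equiv_mem_iff[OF assms replace_inverse_replace]
  by (simp add: replace_logic_eq_vimage replace_vimage_CExtE fvars assms)

lemma replace_logic_subset_iff:
  assumes "S \<in> CExtE" "T \<in> CExtE"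
  shows "replace_logic r S \<subseteq> replace_logic r T \<longleftrightarrow> S \<subseteq> T"
proof
  have mem: "p \<star> r \<in> replace_logic r U \<longleftrightarrow> p \<in> U" if "U \<in> CExtE" for p U
    using E_equiv_mem_iff[OF that replace_replace_inverse]
    by (simp add: replace_logic_eq_vimage that)
  assume "replace_logic r S \<subseteq> replace_logic r T"
  then show "S \<subseteq> T"
    using mem assms by blast
qed (auto simp: replace_logic_def)

lemma replace_map_lattice_auto: "replace_map r \<in> lattice_auto CExtE_lattice"
proof (rule lattice.order_iso_lattice_auto[OF lattice_CExtE])
  have "inj_on (replace_logic r) CExtE"
    by (intro inj_onI subset_antisym) (simp_all flip: replace_logic_subset_iff)
  moreover have "S \<in> replace_logic r ` CExtE" if "S \<in> CExtE" for S
    using replace_logic_vimage[OF that] replace_vimage_CExtE[OF fvars that] by (metis imageI)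
  ultimately have "bij_betw (replace_logic r) CExtE CExtE"
    using replace_logic_CExtE by (auto simp: bij_betw_def)
  then show "replace_map r \<in> Bij (carrier CExtE_lattice)"
    by (simp add: Bij_def replace_map_def CExtE_lattice_def)
qed (simp add: CExtE_lattice_def replace_map_def replace_logic_subset_iff)

end

section \<open>One-point frames\<close>

text \<open>Truth in the one-point neighbourhood frame in which \<open>Dia\<close> sends the full set to
  \<open>fst s\<close> and the empty set to \<open>snd s\<close>.\<close>

primrec point_eval :: "bool \<times> bool \<Rightarrow> (nat \<Rightarrow> bool) \<Rightarrow> fm \<Rightarrow> bool" where
  "point_eval s v (Var i) \<longleftrightarrow> v i"
| "point_eval s v Fls \<longleftrightarrow> False"
| "point_eval s v Tru \<longleftrightarrow> True"
| "point_eval s v (Neg p) \<longleftrightarrow> \<not> point_eval s v p"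
| "point_eval s v (Or p q) \<longleftrightarrow> point_eval s v p \<or> point_eval s v q"
| "point_eval s v (Dia p) \<longleftrightarrow> (if point_eval s v p then fst s else snd s)"

definition point_logic :: "bool \<times> bool \<Rightarrow> fm set"
  where "point_logic s = {p. \<forall>v. point_eval s v p}"

definition point_action :: "fm \<Rightarrow> bool \<times> bool \<Rightarrow> bool \<times> bool"
  where "point_action r s = (point_eval s (\<lambda>_. True) r, point_eval s (\<lambda>_. False) r)"

lemma point_eval_beval: "point_eval s v p = beval v (\<lambda>q. point_eval s v (Dia q)) p"
  by (induction p) auto

lemma point_eval_subst: "point_eval s v (subst t p) = point_eval s (\<lambda>i. point_eval s v (t i)) p"
  by (induction p) auto

lemma point_eval_const:
  "point_eval s (\<lambda>_. b) p = (if b then fst (point_action p s) else snd (point_action p s))"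
  by (cases b) (simp_all add: point_action_def)

lemma point_logic_CExtE: "point_logic s \<in> CExtE"
proof (rule CExtE_I)
  show "p \<in> point_logic s" if "p \<in> tautologies" for p
    using that point_eval_beval unfolding tautologies_def point_logic_def by blast
qed (auto simp: point_logic_def point_eval_subst)

lemma point_logic_eq_iff: "point_logic s = point_logic t \<longleftrightarrow> s = t"
proof -
  have "Dia Tru \<in> point_logic s \<longleftrightarrow> fst s" "Dia Fls \<in> point_logic s \<longleftrightarrow> snd s" for s
    by (simp_all add: point_logic_def)
  then show ?thesis
    by (intro iffI prod_eqI) blast+
qed

lemma E_equiv_point_eval: "p \<approx> q \<Longrightarrow> point_eval s v p = point_eval s v q"
  using CExtE_imp_E_subset[OF point_logic_CExtE[of s]]
  by (auto simp: E_equiv_def point_logic_def)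

lemma E_equiv_point_action: "p \<approx> q \<Longrightarrow> point_action p = point_action q"
  by (simp add: point_action_def E_equiv_point_eval fun_eq_iff)

lemma point_eval_fvars_cong:
  "(\<And>i. i \<in> fvars p \<Longrightarrow> v i = w i) \<Longrightarrow> point_eval s v p = point_eval s w p"
  by (induction p) auto

lemma point_eval_replace:
  assumes "fvars r \<subseteq> {0}"
  shows "point_eval s v (p \<star> r) = point_eval (point_action r s) v p"
proof (induction p)
  case (Dia p)
  have "point_eval s v (Dia p \<star> r) = point_eval s (\<lambda>_. point_eval s v (p \<star> r)) r"
    unfolding replace.simps point_eval_subst
    by (rule point_eval_fvars_cong) (use assms in auto)
  then show ?case
    using Dia by (simp add: point_eval_const)
qed auto

lemma point_action_replace:
  "fvars r \<subseteq> {0} \<Longrightarrow> point_action (q \<star> r) = point_action q \<circ> point_action r"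
  by (simp add: fun_eq_iff point_action_def[of "q \<star> r"] point_action_def[of q] point_eval_replace)

lemma (in invertible_UR) replace_logic_point_logic:
  "replace_logic r (point_logic (point_action r s)) = point_logic s"
proof -
  have "point_logic (point_action r s) = {p. p \<star> r \<in> point_logic s}"
    by (simp add: point_logic_def point_eval_replace[OF fvars])
  then show ?thesis
    by (simp add: replace_logic_vimage point_logic_CExtE)
qed

inductive prime_span :: "fm \<Rightarrow> bool" where
  "prime_span e"
| "prime_span Fls"
| "prime_span Tru"
| "prime_span (Dia e)"
| "prime_span (Dia (Neg e))"
| "prime_span p \<Longrightarrow> prime_span (Neg p)"
| "prime_span p \<Longrightarrow> prime_span q \<Longrightarrow> prime_span (Or p q)"

lemma prime_span_fvars: "prime_span p \<Longrightarrow> fvars p \<subseteq> {0}"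
  by (induction rule: prime_span.induct) auto

text \<open>The one-point frame in which \<open>e\<close>, \<open>Dia e\<close> and \<open>Dia (Neg e)\<close> take the truth values
  prescribed by \<open>v\<close> and \<open>d\<close>. As it always exists, one-point frames decide \<open>\<approx>\<close> on the span.\<close>

definition local_frame :: "(nat \<Rightarrow> bool) \<Rightarrow> (fm \<Rightarrow> bool) \<Rightarrow> bool \<times> bool"
  where "local_frame v d = (if v 0 then (d e, d (Neg e)) else (d (Neg e), d e))"

lemma prime_span_beval:
  assumes "prime_span p"
  shows "beval v d p = point_eval (local_frame v d) (\<lambda>_. v 0) p"
  using assms by induction (auto simp: local_frame_def)

lemma beval_subst: "beval v d (subst s p) = beval (\<lambda>i. beval v d (s i)) (\<lambda>q. d (subst s q)) p"
  by (induction p) auto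

lemma prime_span_beval_replace:
  assumes span: "prime_span q" "prime_span r" and double_neg: "d (Neg (Neg e)) = d e"
  shows "beval v d (q \<star> r) = point_eval (local_frame v d) (\<lambda>_. v 0) (q \<star> r)"
proof -
  let ?s = "local_frame v d"
  have at_e: "beval v d (Dia e \<star> r) = point_eval ?s (\<lambda>_. v 0) r"
    by (simp add: subst_Var prime_span_beval[OF span(2)])
  have at_Neg_e: "beval v d (Dia (Neg e) \<star> r) = point_eval ?s (\<lambda>_. \<not> v 0) r"
    by (simp add: beval_subst prime_span_beval[OF span(2)] local_frame_def double_neg)
  have "local_frame v (\<lambda>q. beval v d (Dia q \<star> r)) = point_action r ?s"
    unfolding local_frame_def[of v "\<lambda>q. beval v d (Dia q \<star> r)"] at_e at_Neg_e
    by (simp add: point_action_def)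
  then show ?thesis
    unfolding beval_replace[of v d q] point_eval_replace[OF prime_span_fvars[OF span(2)]]
    by (simp only: prime_span_beval[OF span(1)])
qed

lemma prime_span_replace_equiv:
  assumes span: "prime_span q" "prime_span r" "prime_span t"
    and action: "point_action t = point_action q \<circ> point_action r"
  shows "q \<star> r \<approx> t"
  unfolding E_equiv_def
proof (rule CExtE_conseq[OF logic_E_in_CExtE])
  have "Iff (Neg (Neg e)) e \<in> logic_E"
    by (rule CExtE_tautology[OF logic_E_in_CExtE]) auto
  then show "{Iff (Dia (Neg (Neg e))) (Dia e)} \<subseteq> logic_E"
    using CExtE_RE[OF logic_E_in_CExtE] by simp
next
  fix v d assume "\<forall>p \<in> {Iff (Dia (Neg (Neg e))) (Dia e)}. beval v d p"
  then have "d (Neg (Neg e)) = d e"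
    by auto
  then have "beval v d (q \<star> r) = beval v d t"
    unfolding prime_span_beval[OF span(3)]
    by (simp add: prime_span_beval_replace[OF span(1,2)] point_eval_const action
        point_action_replace[OF prime_span_fvars[OF span(2)]])
  then show "beval v d (Iff (q \<star> r) t)"
    by simp
qed simp

section \<open>Prime uniform replacements\<close>

lemma prime_forms_prime_span: "r \<in> prime_forms \<Longrightarrow> prime_span r"
  unfolding prime_forms_def by (auto intro!: prime_span.intros)

definition prime_form_list :: "fm list"
  where "prime_form_list =
    [Iff l t. l \<leftarrow> [Dia e, Neg (Dia e)],
       t \<leftarrow> [Tru, e, Or e (Dia (Neg e)), Or e (Neg (Dia (Neg e))),
            Or (Neg e) (Dia (Neg e)), Or (Neg e) (Neg (Dia (Neg e)))]] @
    [Iff l t. l \<leftarrow> [Dia (Neg e), Neg (Dia (Neg e))],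
       t \<leftarrow> [Tru, e, Or e (Dia e), Or e (Neg (Dia e)),
            Or (Neg e) (Dia e), Or (Neg e) (Neg (Dia e))]]"

lemma set_prime_form_list: "set prime_form_list = prime_forms"
proof -
  have "{Iff l t | l t. l \<in> X \<and> t \<in> Y} = (\<Union>l \<in> X. Iff l ` Y)" for X Y
    by blast
  then show ?thesis
    unfolding prime_forms_def prime_form_list_def set_append set_concat set_map image_image
    by (simp only: list.set image_insert image_empty)
qed

lemma inj_point_action_prime_form:
  assumes "r \<in> prime_forms"
  shows "inj (point_action r)"
proof -
  have "\<forall>r \<in> set prime_form_list. inj (point_action r)"
    by (simp add: prime_form_list_def point_action_def inj_def all_bool_eq)
  then show ?thesis
    using assms by (simp add: set_prime_form_list)
qed

lemma inj_on_point_action_prime_forms: "inj_on point_action prime_forms"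
proof -
  have "distinct (map point_action prime_form_list)"
    by (simp add: prime_form_list_def point_action_def fun_eq_iff all_bool_eq)
  then show ?thesis
    by (simp add: distinct_map set_prime_form_list)
qed

lemma point_action_prime_forms: "point_action ` prime_forms = {\<pi>. bij \<pi>}"
proof (rule card_subset_eq)
  show "point_action ` prime_forms \<subseteq> {\<pi>. bij \<pi>}"
    using inj_point_action_prime_form finite_UNIV_inj_surj[OF finite] by (auto simp: bij_def)
  have "{\<pi> :: bool \<times> bool \<Rightarrow> bool \<times> bool. bij \<pi>} = {\<pi>. \<pi> permutes UNIV}"
    by (simp add: permutes_univ bij_iff)
  moreover have "card {\<pi> :: bool \<times> bool \<Rightarrow> bool \<times> bool. \<pi> permutes UNIV} = fact 4"
    by (rule card_permutations) (simp_all flip: UNIV_Times_UNIV)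
  ultimately show "card (point_action ` prime_forms)
      = card {\<pi> :: bool \<times> bool \<Rightarrow> bool \<times> bool. bij \<pi>}"
    by (simp add: card_image[OF inj_on_point_action_prime_forms] card_prime_forms fact_numeral)
qed simp

lemma prime_UR_fvars: "r \<in> prime_UR \<Longrightarrow> fvars r \<subseteq> {0}"
  by (simp add: prime_UR_def UR_def)

lemma prime_forms_subset_prime_UR: "prime_forms \<subseteq> prime_UR"
  using prime_forms_UR E_equiv_refl by (auto simp: prime_UR_def)

lemma prime_URE:
  assumes "r \<in> prime_UR"
  obtains r' where "r' \<in> prime_forms" "r \<approx> r'" "point_action r = point_action r'"
  using assms E_equiv_point_action unfolding prime_UR_def by blast

lemma point_action_prime_UR: "point_action ` prime_UR = {\<pi>. bij \<pi>}"
  using point_action_prime_forms prime_forms_subset_prime_UR by (fastforce elim: prime_URE)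

lemma bij_point_action: "r \<in> prime_UR \<Longrightarrow> bij (point_action r)"
  using point_action_prime_UR by blast

lemma Dia_e_prime_UR: "Dia e \<in> prime_UR"
proof -
  have "Dia e \<approx> Iff (Dia e) Tru"
    unfolding E_equiv_def
    by (rule CExtE_tautology[OF logic_E_in_CExtE]) auto
  then show ?thesis
    by (auto simp: prime_UR_def UR_def prime_forms_def)
qed

lemma point_action_Dia_e: "point_action (Dia e) = id"
  by (auto simp: point_action_def)

lemma prime_UR_replace_equiv:
  assumes prime: "q \<in> prime_UR" "r \<in> prime_UR" "t \<in> prime_UR"
    and action: "point_action t = point_action q \<circ> point_action r"
  shows "q \<star> r \<approx> t"
proof -
  obtain q' where form_q: "q' \<in> prime_forms" "q \<approx> q'" "point_action q = point_action q'"
    using prime(1) by (rule prime_URE)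
  obtain r' where form_r: "r' \<in> prime_forms" "r \<approx> r'" "point_action r = point_action r'"
    using prime(2) by (rule prime_URE)
  obtain t' where form_t: "t' \<in> prime_forms" "t \<approx> t'" "point_action t = point_action t'"
    using prime(3) by (rule prime_URE)
  have "q \<star> r \<approx> q' \<star> r"
    by (rule E_equiv_replace_left[OF prime_UR_fvars[OF prime(2)] form_q(2)])
  also have "\<dots> \<approx> q' \<star> r'"
    by (rule E_equiv_replace_right[OF form_r(2)])
  also have "\<dots> \<approx> t'"
    using form_q form_r form_t action
    by (intro prime_span_replace_equiv prime_forms_prime_span) simp_all
  also have "\<dots> \<approx> t"
    by (rule E_equiv_sym[OF form_t(2)])
  finally show ?thesis .
qed

lemma prime_UR_equiv:
  assumes "q \<in> prime_UR" "r \<in> prime_UR" "point_action q = point_action r"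
  shows "q \<approx> r"
  using prime_UR_replace_equiv[OF assms(1) Dia_e_prime_UR assms(2)] assms(3)
  by (simp add: replace_Dia_e point_action_Dia_e)

lemma prime_UR_invertible:
  assumes prime: "r \<in> prime_UR"
  obtains r' where "invertible_UR r r'"
proof -
  note bij = bij_point_action[OF prime]
  then obtain r' where inverse: "r' \<in> prime_UR" "point_action r' = inv' (point_action r)"
    using point_action_prime_UR bij_imp_bij_inv by (metis imageE mem_Collect_eq)
  have "r \<star> r' \<approx> Dia e" "r' \<star> r \<approx> Dia e"
    using bij prime inverse
    by (auto intro!: prime_UR_replace_equiv Dia_e_prime_UR
        simp: point_action_Dia_e bij_def surj_iff inj_iff)
  then show ?thesis
    using prime_UR_fvars prime inverse(1) by (intro that invertible_UR.intro)
qed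

lemma
  assumes "r \<in> prime_UR"
  shows prime_UR_replace_logic_CExtE: "S \<in> CExtE \<Longrightarrow> replace_logic r S \<in> CExtE"
    and prime_UR_lattice_auto: "replace_map r \<in> lattice_auto CExtE_lattice"
proof -
  obtain r' where "invertible_UR r r'"
    using assms by (rule prime_UR_invertible)
  then interpret invertible_UR r r' .
  show "S \<in> CExtE \<Longrightarrow> replace_logic r S \<in> CExtE"
    by (rule replace_logic_CExtE)
  show "replace_map r \<in> lattice_auto CExtE_lattice"
    by (rule replace_map_lattice_auto)
qed

section \<open>The group of prime automorphisms\<close>

definition UR_of_perm :: "(bool \<times> bool \<Rightarrow> bool \<times> bool) \<Rightarrow> fm"
  where "UR_of_perm \<pi> = (SOME r. r \<in> prime_UR \<and> point_action r = \<pi>)"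

text \<open>The inverse makes up for the contravariance
  \<open>replace_logic q (replace_logic r S) = replace_logic (r \<star> q) S\<close>.\<close>

definition perm_auto :: "(bool \<times> bool \<Rightarrow> bool \<times> bool) \<Rightarrow> fm set \<Rightarrow> fm set"
  where "perm_auto \<pi> = replace_map (UR_of_perm (inv' \<pi>))"

lemma
  assumes "bij \<pi>"
  shows UR_of_perm_prime_UR: "UR_of_perm \<pi> \<in> prime_UR"
    and point_action_UR_of_perm: "point_action (UR_of_perm \<pi>) = \<pi>"
proof -
  have "\<pi> \<in> point_action ` prime_UR"
    using assms by (simp add: point_action_prime_UR)
  then have "\<exists>r. r \<in> prime_UR \<and> point_action r = \<pi>"
    by blast
  from someI_ex[OF this] show "UR_of_perm \<pi> \<in> prime_UR" "point_action (UR_of_perm \<pi>) = \<pi>"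
    by (simp_all add: UR_of_perm_def)
qed

lemma replace_map_eq_perm_auto:
  assumes prime: "r \<in> prime_UR"
  shows "replace_map r = perm_auto (inv' (point_action r))"
proof -
  have "r \<approx> UR_of_perm (point_action r)"
    by (intro prime_UR_equiv prime UR_of_perm_prime_UR point_action_UR_of_perm[symmetric]
        bij_point_action)
  then show ?thesis
    unfolding perm_auto_def inv_inv_eq[OF bij_point_action[OF prime]] by (rule replace_map_cong)
qed

lemma perm_auto_image: "perm_auto ` {\<pi>. bij \<pi>} = prime_autos"
proof
  have "perm_auto \<pi> \<in> prime_autos" if "bij \<pi>" for \<pi>
    unfolding prime_autos_def perm_auto_def
    by (rule imageI[OF UR_of_perm_prime_UR[OF bij_imp_bij_inv[OF that]]])
  then show "perm_auto ` {\<pi>. bij \<pi>} \<subseteq> prime_autos"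
    by blast
  have "replace_map r \<in> perm_auto ` {\<pi>. bij \<pi>}" if "r \<in> prime_UR" for r
    unfolding replace_map_eq_perm_auto[OF that]
    by (intro imageI CollectI bij_imp_bij_inv bij_point_action that)
  then show "prime_autos \<subseteq> perm_auto ` {\<pi>. bij \<pi>}"
    unfolding prime_autos_def by blast
qed

lemma perm_auto_point_logic:
  assumes "bij \<pi>"
  shows "perm_auto \<pi> (point_logic s) = point_logic (\<pi> s)"
proof -
  let ?r = "UR_of_perm (inv' \<pi>)"
  have bij: "bij (inv' \<pi>)"
    using assms by (rule bij_imp_bij_inv)
  obtain r' where inverse: "invertible_UR ?r r'"
    using UR_of_perm_prime_UR[OF bij] by (rule prime_UR_invertible)
  have "point_action ?r (\<pi> s) = s"
    unfolding point_action_UR_of_perm[OF bij] by (rule inv_f_f[OF bij_is_inj[OF assms]])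
  with invertible_UR.replace_logic_point_logic[OF inverse, of "\<pi> s"]
  have "replace_logic ?r (point_logic s) = point_logic (\<pi> s)"
    by (simp only:)
  then show ?thesis
    unfolding perm_auto_def replace_map_def restrict_apply'[OF point_logic_CExtE] .
qed

lemma perm_auto_inj: "inj_on perm_auto {\<pi>. bij \<pi>}"
proof (intro inj_onI ext)
  fix \<pi> \<sigma> s
  assume bij: "\<pi> \<in> {\<pi>. bij \<pi>}" "\<sigma> \<in> {\<pi>. bij \<pi>}" and eq: "perm_auto \<pi> = perm_auto \<sigma>"
  have "perm_auto \<pi> (point_logic s) = perm_auto \<sigma> (point_logic s)"
    using eq by simp
  then show "\<pi> s = \<sigma> s"
    using bij by (simp add: perm_auto_point_logic point_logic_eq_iff)
qed

lemma perm_auto_comp: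
  assumes "bij \<pi>" "bij \<sigma>"
  shows "perm_auto (\<pi> \<circ> \<sigma>) = compose CExtE (perm_auto \<pi>) (perm_auto \<sigma>)"
proof -
  let ?q = "UR_of_perm (inv' \<pi>)" and ?r = "UR_of_perm (inv' \<sigma>)"
    and ?t = "UR_of_perm (inv' (\<pi> \<circ> \<sigma>))"
  note bij = assms[THEN bij_imp_bij_inv] bij_imp_bij_inv[OF bij_comp[OF assms(2,1)]]
  note prime = bij[THEN UR_of_perm_prime_UR] and action = bij[THEN point_action_UR_of_perm]
  have "?r \<star> ?q \<approx> ?t"
    by (rule prime_UR_replace_equiv[OF prime(2,1,3)])
      (unfold action, rule o_inv_distrib[OF assms])
  then have "replace_map ?t = replace_map (?r \<star> ?q)"
    by (rule replace_map_cong[OF E_equiv_sym])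
  then show ?thesis
    by (simp add: perm_auto_def replace_map_def compose_def prime_UR_replace_logic_CExtE
        replace_logic_replace_logic prime_UR_fvars prime cong: restrict_cong)
qed

lemma prime_autos_lattice_auto: "prime_autos \<subseteq> lattice_auto CExtE_lattice"
  by (auto simp: prime_autos_def prime_UR_lattice_auto)

lemma carrier_BijGroup_UNIV: "carrier (BijGroup UNIV) = {\<pi>. bij \<pi>}"
  by (simp add: BijGroup_def Bij_def)

lemma mult_BijGroup_UNIV: "bij \<pi> \<Longrightarrow> bij \<sigma> \<Longrightarrow> \<pi> \<otimes>\<^bsub>BijGroup UNIV\<^esub> \<sigma> = \<pi> \<circ> \<sigma>"
  by (simp add: BijGroup_def Bij_def compose_def comp_def restrict_def)

lemma perm_auto_hom: "perm_auto \<in> hom (BijGroup UNIV) (BijGroup CExtE)"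
proof (rule homI; unfold carrier_BijGroup_UNIV mem_Collect_eq)
  have Bij: "perm_auto \<pi> \<in> Bij CExtE" if "bij \<pi>" for \<pi>
    using that perm_auto_image prime_autos_lattice_auto
    by (auto simp: lattice_auto_def CExtE_lattice_def)
  then show "perm_auto \<pi> \<in> carrier (BijGroup CExtE)" if "bij \<pi>" for \<pi>
    using that by (simp add: BijGroup_def)
  show "perm_auto (\<pi> \<otimes>\<^bsub>BijGroup UNIV\<^esub> \<sigma>) = perm_auto \<pi> \<otimes>\<^bsub>BijGroup CExtE\<^esub> perm_auto \<sigma>"
    if "bij \<pi>" "bij \<sigma>" for \<pi> \<sigma>
    using that by (simp add: mult_BijGroup_UNIV perm_auto_comp) (simp add: BijGroup_def Bij)
qed

lemma prime_autos_subgroup: "subgroup prime_autos (BijGroup CExtE)"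
proof -
  interpret group_hom "BijGroup UNIV" "BijGroup CExtE" perm_auto
    by (intro group_hom.intro group_hom_axioms.intro group_BijGroup perm_auto_hom)
  show ?thesis
    using img_is_subgroup by (simp only: carrier_BijGroup_UNIV perm_auto_image)
qed

lemma perm_auto_iso:
  "perm_auto \<in> iso (BijGroup UNIV) (BijGroup CExtE\<lparr>carrier := prime_autos\<rparr>)"
  using perm_auto_hom perm_auto_inj perm_auto_image
  by (auto simp: iso_iff hom_def carrier_BijGroup_UNIV)

lemma prime_autos_iso_sym_group: "BijGroup CExtE\<lparr>carrier := prime_autos\<rparr> \<cong> sym_group 4"
proof -
  have "BijGroup CExtE\<lparr>carrier := prime_autos\<rparr> \<cong> BijGroup (UNIV :: (bool \<times> bool) set)"
    by (rule group.iso_sym[OF group_BijGroup is_isoI[OF perm_auto_iso]])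
  also have "\<dots> \<cong> sym_group (card (UNIV :: (bool \<times> bool) set))"
    by (rule BijGroup_iso_sym_group) (rule finite)
  also have "card (UNIV :: (bool \<times> bool) set) = 4"
    by (simp flip: UNIV_Times_UNIV)
  finally show ?thesis .
qed

theorem theorem15:
  shows "(\<forall>\<rho> \<in> prime_UR.
            (\<forall>S \<in> CExtE. replace_logic \<rho> S \<in> CExtE) \<and>
            replace_map \<rho> \<in> lattice_auto CExtE_lattice) \<and>
         prime_autos \<subseteq> lattice_auto CExtE_lattice \<and>
         group (BijGroup CExtE\<lparr>carrier := prime_autos\<rparr>) \<and>
         BijGroup CExtE\<lparr>carrier := prime_autos\<rparr> \<cong> sym_group 4"
proof (intro conjI ballI)
  show "replace_logic \<rho> S \<in> CExtE" if "\<rho> \<in> prime_UR" "S \<in> CExtE" for \<rho> S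
    using that by (rule prime_UR_replace_logic_CExtE)
  show "replace_map \<rho> \<in> lattice_auto CExtE_lattice" if "\<rho> \<in> prime_UR" for \<rho>
    using that by (rule prime_UR_lattice_auto)
  show "prime_autos \<subseteq> lattice_auto CExtE_lattice"
    by (rule prime_autos_lattice_auto)
  show "group (BijGroup CExtE\<lparr>carrier := prime_autos\<rparr>)"
    using prime_autos_subgroup group_BijGroup by (rule subgroup.subgroup_is_group)
  show "BijGroup CExtE\<lparr>carrier := prime_autos\<rparr> \<cong> sym_group 4"
    by (rule prime_autos_iso_sym_group)
qed

end
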